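(* Let $N$ and $K$ be positive integers, let $\mathbf{y} \in \mathbb{R}^N$, let $\lambda > 0$, and let $a>0$ be such that $\phi(\cdot\,; a) : \mathbb{R} \to \mathbb{R}$ is a penalty function satisfying assumptions (1)--(7) listed in the context. Define $F : \mathbb{R}^N \to \mathbb{R}$ by $$F(\mathbf{x}) = \frac{1}{2} \|\mathbf{y} - \mathbf{x}\|_2^2 + \lambda \sum_{i=-(K-1)}^{N-1} \phi(\|\mathbf{x}_{i,K}\|_2; a).$$ If $$\phi''(0^+; a) > -\frac{1}{K\lambda},$$ then $F$ is strictly convex.
   Context: Vectors in $\mathbb{R}^N$ are indexed as $\mathbf{x} = [x(0),\dots,x(N-1)]$. For $i \in \mathbb{Z}$, the $i$-th group of size $K$ is $\mathbf{x}_{i,K} = [x(i),\dots,x(i+K-1)] \in \mathbb{R}^K$, with the convention $x(j)=0$ for $j \notin \{0,\dots,N-1\}$. The sum in $F$ runs over all (fully overlapping) groups that contain at least one index of $\{0,\dots,N-1\}$. Assumptions on a penalty function $\phi:\mathbb{R}\to\mathbb{R}$ (here $\phi = \phi(\cdot\,;a)$, where $a$ is a fixed scalar parameter; derivatives are with respect to the first argument): (1) $\phi$ is continuous on $\mathbb{R}$; (2) $\phi$ is twice differentiable on $\mathbb{R}\setminus\{0\}$; (3) $\phi(-x)=\phi(x)$ for all $x$; (4) $\phi'(x)>0$ for all $x>0$; (5) $\phi''(x)\le 0$ for all $x>0$; (6) $\phi'(0^+)=1$; (7) $\phi''(0^+)\le \phi''(x)$ for all $x>0$. Here $\phi'(0^+)$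 is the right-sided derivative of $\phi$ at $0$, and $\phi''(0^+)$ is the right-sided second derivative of $\phi$ at $0$ (the right-sided derivative at $0$ of the function equal to $\phi'$ on $(0,\infty)$ and to $\phi'(0^+)$ at $0$). *)

theory Defs
  imports "HOL-Analysis.Derivative" "HOL-Analysis.L2_Norm" "Jordan_Normal_Form.Matrix"
begin

definition right_deriv :: "(real \<Rightarrow> real) \<Rightarrow> real \<Rightarrow> real" where
  "right_deriv f x = (THE D. (f has_real_derivative D) (at_right x))"

text \<open>
  The derivative of \<open>f\<close> on the open half-line \<open>x > 0\<close>, extended by the right-sided derivative
  at \<open>0\<close>. The values at negative arguments are irrelevant, since this function is only used
  through its right-sided derivative at \<open>0\<close>.
\<close>

definition deriv_right_ext :: "(real \<Rightarrow> real) \<Rightarrow> real \<Rightarrow> real" where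
  "deriv_right_ext f x = (if x = 0 then right_deriv f 0 else deriv f x)"

definition right_deriv2_at_0 :: "(real \<Rightarrow> real) \<Rightarrow> real" where
  "right_deriv2_at_0 f = right_deriv (deriv_right_ext f) 0"

text \<open>
  The two clauses \<open>_ differentiable at_right 0\<close> state that the one-sided derivatives at \<open>0\<close>
  exist as real numbers, so that \<open>right_deriv\<close> denotes them.
\<close>

definition penalty :: "(real \<Rightarrow> real) \<Rightarrow> bool" where
  "penalty \<phi> \<longleftrightarrow>
     continuous_on UNIV \<phi> \<and>
     (\<forall>x. x \<noteq> 0 \<longrightarrow> \<phi> differentiable at x \<and> deriv \<phi> differentiable at x) \<and>
     (\<forall>x. \<phi> (- x) = \<phi> x) \<and>
     (\<forall>x>0. deriv \<phi> x > 0) \<and>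
     (\<forall>x>0. deriv (deriv \<phi>) x \<le> 0) \<and>
     \<phi> differentiable at_right 0 \<and> right_deriv \<phi> 0 = 1 \<and>
     deriv_right_ext \<phi> differentiable at_right 0 \<and>
     (\<forall>x>0. right_deriv2_at_0 \<phi> \<le> deriv (deriv \<phi>) x)"

definition norm2 :: "real vec \<Rightarrow> real" where
  "norm2 v = L2_set (\<lambda>j. v $ j) {..<dim_vec v}"

definition coord :: "real vec \<Rightarrow> int \<Rightarrow> real" where
  "coord x j = (if 0 \<le> j \<and> j < int (dim_vec x) then x $ nat j else 0)"

definition vec_group :: "nat \<Rightarrow> real vec \<Rightarrow> int \<Rightarrow> real vec" where
  "vec_group K x i = vec K (\<lambda>m. coord x (i + int m))"

text \<open>
  The penalty family is curried with its parameter first: \<open>\<phi> a\<close> is the function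
  \<open>t \<mapsto> \<phi>(t; a)\<close>.
\<close>

definition objective ::
    "(real \<Rightarrow> real \<Rightarrow> real) \<Rightarrow> real \<Rightarrow> real \<Rightarrow> nat \<Rightarrow> nat \<Rightarrow> real vec \<Rightarrow> real vec \<Rightarrow> real" where
  "objective \<phi> a lam N K y x =
     1 / 2 * (norm2 (y - x))\<^sup>2
     + lam * (\<Sum>i = - (int K - 1)..int N - 1. \<phi> a (norm2 (vec_group K x i)))"

text \<open>The type of vectors is not a real vector space, but \<open>carrier_vec N\<close> is one.\<close>

definition strictly_convex :: "nat \<Rightarrow> (real vec \<Rightarrow> real) \<Rightarrow> bool" where
  "strictly_convex N F \<longleftrightarrow>
     (\<forall>u\<in>carrier_vec N. \<forall>v\<in>carrier_vec N. \<forall>t. u \<noteq> v \<and> 0 < t \<and> t < 1 \<longrightarrow>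
        F ((1 - t) \<cdot>\<^sub>v u + t \<cdot>\<^sub>v v) < (1 - t) * F u + t * F v)"

end

(*
  With c = - phi''(0+), the function psi(s) = phi(s) + c s^2 / 2 is convex and nondecreasing on
  [0, infinity), so psi(||x_i||) is convex in x for every group. Each index lies in exactly K of
  the groups, so the added quadratic terms sum up to K c ||x||^2 / 2; subtracting lam times this
  from ||y - x||^2 / 2 leaves a strictly convex quadratic because lam c K < 1.
*)

theory Submission
  imports Defs "HOL-Analysis.Convex"
begin

unbundle no vec_syntax

lemma penalty_plus_quadratic_has_deriv:
  assumes "penalty f" "x \<noteq> 0"
  shows "((\<lambda>t. f t + c / 2 * t\<^sup>2) has_real_derivative (deriv f x + c * x)) (at x)"
    and "((\<lambda>t. deriv f t + c * t) has_real_derivative (deriv (deriv f) x + c)) (at x)"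
proof -
  have "(f has_real_derivative deriv f x) (at x)"
    "(deriv f has_real_derivative deriv (deriv f) x) (at x)"
    using assms unfolding penalty_def by (auto simp: DERIV_deriv_iff_real_differentiable)
  then show "((\<lambda>t. f t + c / 2 * t\<^sup>2) has_real_derivative (deriv f x + c * x)) (at x)"
    "((\<lambda>t. deriv f t + c * t) has_real_derivative (deriv (deriv f) x + c)) (at x)"
    by (auto intro!: derivative_eq_intros)
qed

lemma penalty_plus_quadratic_continuous:
  assumes "penalty f"
  shows "continuous_on UNIV (\<lambda>t. f t + c / 2 * t\<^sup>2)"
  using assms unfolding penalty_def by (auto intro!: continuous_intros)

text \<open>Monotonicity lets the upper bound \<open>norm2_convex_combination\<close> pass through
  the outer function. The derivative \<open>deriv f x + c * x\<close> is positive for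
  \<open>x > 0\<close>.\<close>

lemma penalty_plus_quadratic_mono:
  assumes "penalty f" "c \<ge> 0" "0 \<le> p" "p \<le> q"
  shows "f p + c / 2 * p\<^sup>2 \<le> f q + c / 2 * q\<^sup>2"
\<comment> \<open>The rule asks for derivatives only strictly between \<open>p\<close> and
  \<open>q\<close>; this admits \<open>p = 0\<close>, where \<open>f\<close> may have a kink and
  only continuity is at hand.\<close>
proof (rule DERIV_nonneg_imp_increasing_open[OF assms(4)])
  fix x assume "p < x" "x < q"
  then have "0 < x" using assms(3) by simp
  then have "0 < deriv f x"
    using assms(1) unfolding penalty_def by blast
  then have "0 \<le> deriv f x + c * x"
    using \<open>0 < x\<close> assms(2) by simp
  then show "\<exists>D. ((\<lambda>t. f t + c / 2 * t\<^sup>2) has_real_derivative D) (at x) \<and> 0 \<le> D"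
    using penalty_plus_quadratic_has_deriv(1)[OF assms(1)] \<open>0 < x\<close>
    by (intro exI[of _ "deriv f x + c * x"]) simp
next
  show "continuous_on {p..q} (\<lambda>t. f t + c / 2 * t\<^sup>2)"
    by (rule continuous_on_subset[OF penalty_plus_quadratic_continuous[OF assms(1)]]) simp
qed

text \<open>The second derivative test applies only away from \<open>0\<close>. Shifting both points
  by \<open>e > 0\<close> moves them into the open half-line, and the convexity inequality survives
  the limit as \<open>e\<close> tends to \<open>0\<close>.\<close>

lemma convex_on_atLeast_of_greaterThan:
  fixes g :: "real \<Rightarrow> real"
  assumes "convex_on {0<..} g" "continuous_on UNIV g"
  shows "convex_on {0..} g"
proof (rule convex_onI)
  fix t x z :: real
  assume *: "0 < t" "t < 1" "x \<in> {0..}" "z \<in> {0..}"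
  \<comment> \<open>\<open>h e\<close> is the slack in the inequality for the shifted points. The
    weights sum to \<open>1\<close>, so the convex combination is shifted by the same
    \<open>e\<close>.\<close>
  define h where
    "h e = (1 - t) * g (x + e) + t * g (z + e) - g ((1 - t) * x + t * z + e)" for e
  have "continuous_on UNIV h"
    unfolding h_def by (intro continuous_intros continuous_on_compose2[OF assms(2)]) auto
  then have "(h \<longlongrightarrow> h 0) (at_right 0)"
    by (simp add: continuous_on_eq_continuous_at isCont_def filterlim_at_split)
  moreover have "0 \<le> h e" if "e > 0" for e
    using convex_onD[OF assms(1), of t "x + e" "z + e"] * that
    by (simp add: h_def algebra_simps)
  ultimately have "0 \<le> h 0"
    by (intro tendsto_lowerbound[of h "h 0" "at_right 0"])
      (auto simp: eventually_at_right_less eventually_at_filter)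
  then show "g ((1 - t) *\<^sub>R x + t *\<^sub>R z) \<le> (1 - t) * g x + t * g z"
    by (simp add: h_def)
qed simp

text \<open>By assumption (7), \<open>right_deriv2_at_0 f\<close> bounds the second derivative of
  \<open>f\<close> from below on the open half-line, so adding \<open>c\<close> makes it
  nonnegative.\<close>

lemma penalty_plus_quadratic_convex:
  assumes "penalty f" "- right_deriv2_at_0 f \<le> c"
  shows "convex_on {0..} (\<lambda>t. f t + c / 2 * t\<^sup>2)"
proof (rule convex_on_atLeast_of_greaterThan[OF _ penalty_plus_quadratic_continuous[OF assms(1)]])
  have "0 \<le> deriv (deriv f) x + c" if "x > 0" for x
    using assms that unfolding penalty_def by fastforce
  then show "convex_on {0<..} (\<lambda>t. f t + c / 2 * t\<^sup>2)"
    using penalty_plus_quadratic_has_deriv[OF assms(1)]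
    by (intro f''_ge0_imp_convex[where f' = "\<lambda>x. deriv f x + c * x"
          and f'' = "\<lambda>x. deriv (deriv f) x + c"]) auto
qed

lemma norm2_square: "(norm2 v)\<^sup>2 = (\<Sum>j<dim_vec v. (v $ j)\<^sup>2)"
  unfolding norm2_def L2_set_def by (simp add: sum_nonneg)

lemma norm2_nonneg: "0 \<le> norm2 v"
  unfolding norm2_def by simp

lemma norm2_convex_combination:
  assumes "u \<in> carrier_vec n" "v \<in> carrier_vec n" "0 \<le> s" "0 \<le> t"
  shows "norm2 (s \<cdot>\<^sub>v u + t \<cdot>\<^sub>v v) \<le> s * norm2 u + t * norm2 v"
proof -
  have "norm2 (s \<cdot>\<^sub>v u + t \<cdot>\<^sub>v v) = L2_set (\<lambda>j. s * u $ j + t * v $ j) {..<n}"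
    using assms unfolding norm2_def by (auto intro: L2_set_cong)
  also have "\<dots> \<le> L2_set (\<lambda>j. s * u $ j) {..<n} + L2_set (\<lambda>j. t * v $ j) {..<n}"
    by (rule L2_set_triangle_ineq)
  also have "\<dots> = s * norm2 u + t * norm2 v"
    using assms unfolding norm2_def by (simp add: L2_set_right_distrib)
  finally show ?thesis .
qed

lemma vec_group_linear:
  assumes "u \<in> carrier_vec N" "v \<in> carrier_vec N"
  shows "vec_group K (s \<cdot>\<^sub>v u + t \<cdot>\<^sub>v v) i = s \<cdot>\<^sub>v vec_group K u i + t \<cdot>\<^sub>v vec_group K v i"
  using assms by (intro eq_vecI) (auto simp: vec_group_def coord_def nat_less_iff)

text \<open>After swapping the sums, each of the \<open>K\<close> offsets \<open>m\<close> within a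
  group contributes the full squared norm: as \<open>i\<close> varies, \<open>i + int m\<close>
  meets every index once.\<close>

lemma sum_norm2_square_vec_group:
  assumes "x \<in> carrier_vec N"
  shows "(\<Sum>i = - (int K - 1)..int N - 1. (norm2 (vec_group K x i))\<^sup>2) = real K * (norm2 x)\<^sup>2"
proof -
  have "(\<Sum>i = - (int K - 1)..int N - 1. (coord x (i + int m))\<^sup>2) = (\<Sum>j<N. (x $ j)\<^sup>2)"
    if "m < K" for m
  proof -
    \<comment> \<open>The discarded terms are zero padding; \<open>m < K\<close> ensures that the
      smaller range starts no earlier than \<open>- (int K - 1)\<close>.\<close>
    have "(\<Sum>i = - (int K - 1)..int N - 1. (coord x (i + int m))\<^sup>2)
        = (\<Sum>i = - int m..int N - 1 - int m. (coord x (i + int m))\<^sup>2)"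
      using assms that by (intro sum.mono_neutral_right) (auto simp: coord_def)
    also have "\<dots> = (\<Sum>j<N. (x $ j)\<^sup>2)"
      using assms by (intro sum.reindex_bij_witness[where
            i = "\<lambda>j. int j - int m" and j = "\<lambda>i. nat (i + int m)"]) (auto simp: coord_def)
    finally show ?thesis .
  qed
  then have "(\<Sum>m<K. \<Sum>i = - (int K - 1)..int N - 1. (coord x (i + int m))\<^sup>2)
      = real K * (\<Sum>j<N. (x $ j)\<^sup>2)"
    by simp
  then show ?thesis
    using assms by (subst (asm) sum.swap) (simp add: norm2_square vec_group_def)
qed

text \<open>The function is separable: it is a sum over coordinates of quadratics in one variable
  with leading coefficient \<open>(1 - r) / 2 > 0\<close>.\<close>

lemma quadratic_part_strictly_convex:
  assumes "y \<in> carrier_vec N" "r < 1"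
  shows "strictly_convex N (\<lambda>x. 1 / 2 * (norm2 (y - x))\<^sup>2 - r / 2 * (norm2 x)\<^sup>2)"
    (is "strictly_convex N ?G")
  unfolding strictly_convex_def
proof (intro ballI allI impI)
  fix u v :: "real vec" and t :: real
  assume uv: "u \<in> carrier_vec N" "v \<in> carrier_vec N" and t: "u \<noteq> v \<and> 0 < t \<and> t < 1"
  define q where "q j s = 1 / 2 * (y $ j - s)\<^sup>2 - r / 2 * s\<^sup>2" for j s
  have G: "?G x = (\<Sum>j<N. q j (x $ j))" if "x \<in> carrier_vec N" for x
    using assms that by (simp add: norm2_square q_def sum_subtractf sum_distrib_left)
  \<comment> \<open>For a quadratic the gap in the convexity inequality is exact: the leading
    coefficient times \<open>t * (1 - t) * (p - s)\<^sup>2\<close>. One coordinate where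
    \<open>u\<close> and \<open>v\<close> differ then gives strictness.\<close>
  have q_defect: "q j ((1 - t) * p + t * s)
      = (1 - t) * q j p + t * q j s - (1 - r) / 2 * (t * (1 - t)) * (p - s)\<^sup>2" for j p s
    unfolding q_def by (simp add: power2_eq_square field_simps)
  have nonneg: "0 \<le> (1 - r) / 2 * (t * (1 - t)) * (p - s)\<^sup>2" for p s
    using assms t by simp
  obtain k where k: "k < N" "u $ k \<noteq> v $ k"
    using uv t by (metis carrier_vecD eq_vecI)
  have "(\<Sum>j<N. q j ((1 - t) * u $ j + t * v $ j))
      < (\<Sum>j<N. (1 - t) * q j (u $ j) + t * q j (v $ j))"
  proof (rule sum_strict_mono_ex1)
    show "\<forall>j\<in>{..<N}. q j ((1 - t) * u $ j + t * v $ j) \<le> (1 - t) * q j (u $ j) + t * q j (v $ j)"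
      using nonneg by (simp add: q_defect)
    have "0 < (1 - r) / 2 * (t * (1 - t)) * (u $ k - v $ k)\<^sup>2"
      using assms t k by simp
    then show "\<exists>j\<in>{..<N}. q j ((1 - t) * u $ j + t * v $ j) < (1 - t) * q j (u $ j) + t * q j (v $ j)"
      using k(1) by (auto simp: q_defect intro!: bexI[of _ k])
  qed simp
  moreover have "?G ((1 - t) \<cdot>\<^sub>v u + t \<cdot>\<^sub>v v) = (\<Sum>j<N. q j ((1 - t) * u $ j + t * v $ j))"
    using uv by (subst G) auto
  ultimately show "?G ((1 - t) \<cdot>\<^sub>v u + t \<cdot>\<^sub>v v) < (1 - t) * ?G u + t * ?G v"
    by (simp only: G[OF uv(1)] G[OF uv(2)] sum.distrib sum_distrib_left)
qed

text \<open>A nondecreasing convex function on the nonnegative reals composed with the convex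
  function \<open>norm2\<close> is convex.\<close>

lemma penalty_norm2_convex:
  assumes "penalty f" "0 \<le> c" "- right_deriv2_at_0 f \<le> c"
    and "u \<in> carrier_vec n" "v \<in> carrier_vec n" "0 < t" "t < 1"
  defines "g \<equiv> \<lambda>s. f s + c / 2 * s\<^sup>2"
  shows "g (norm2 ((1 - t) \<cdot>\<^sub>v u + t \<cdot>\<^sub>v v)) \<le> (1 - t) * g (norm2 u) + t * g (norm2 v)"
proof -
  have "g (norm2 ((1 - t) \<cdot>\<^sub>v u + t \<cdot>\<^sub>v v)) \<le> g ((1 - t) * norm2 u + t * norm2 v)"
    unfolding g_def using assms
    by (intro penalty_plus_quadratic_mono norm2_convex_combination norm2_nonneg) auto
  also have "\<dots> \<le> (1 - t) * g (norm2 u) + t * g (norm2 v)"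
    using convex_onD[OF penalty_plus_quadratic_convex[OF assms(1,3)], of t "norm2 u" "norm2 v"]
      assms(6,7) by (simp add: g_def norm2_nonneg)
  finally show ?thesis .
qed

theorem theorem1:
  fixes N K :: nat and y :: "real vec" and lam a :: real
    and \<phi> :: "real \<Rightarrow> real \<Rightarrow> real"
  assumes "N > 0" and "K > 0"
    and "y \<in> carrier_vec N"
    and "lam > 0" and "a > 0"
    and "penalty (\<phi> a)"
    and "right_deriv2_at_0 (\<phi> a) > - 1 / (real K * lam)"
  shows "strictly_convex N (objective \<phi> a lam N K y)"
proof -
  define c where "c = - right_deriv2_at_0 (\<phi> a)"
  \<comment> \<open>The quadratics added inside the groups total
    \<open>r / 2 * (norm2 x)\<^sup>2\<close> after weighting by \<open>lam\<close>; \<open>G\<close>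
    takes this amount away again.\<close>
  define r where "r = lam * c * real K"
  define g where "g s = \<phi> a s + c / 2 * s\<^sup>2" for s
  define G where "G x = 1 / 2 * (norm2 (y - x))\<^sup>2 - r / 2 * (norm2 x)\<^sup>2" for x
  define I where "I = {- (int K - 1)..int N - 1}"
  define H where "H x = (\<Sum>i\<in>I. g (norm2 (vec_group K x i)))" for x
  \<comment> \<open>Assumptions (5) and (7), taken at the sample point \<open>1\<close>, give the
    sign of \<open>c\<close>.\<close>
  have "right_deriv2_at_0 (\<phi> a) \<le> deriv (deriv (\<phi> a)) 1" "deriv (deriv (\<phi> a)) 1 \<le> 0"
    using assms(6) unfolding penalty_def by auto
  then have c: "0 \<le> c" "- right_deriv2_at_0 (\<phi> a) \<le> c"
    by (simp_all add: c_def)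
  \<comment> \<open>This is the hypothesis on the second derivative at \<open>0\<close>, multiplied
    by \<open>real K * lam > 0\<close>.\<close>
  have "r < 1"
    using assms(2,4,7) by (simp add: r_def c_def field_simps)
  then have G: "strictly_convex N G"
    unfolding G_def by (rule quadratic_part_strictly_convex[OF assms(3)])
  have split: "objective \<phi> a lam N K y x = G x + lam * H x" if "x \<in> carrier_vec N" for x
  proof -
    have "H x = (\<Sum>i\<in>I. \<phi> a (norm2 (vec_group K x i))) + c / 2 * (real K * (norm2 x)\<^sup>2)"
      using sum_norm2_square_vec_group[OF that, of K]
      by (simp add: H_def g_def sum.distrib I_def sum_distrib_left[symmetric]
          del: times_divide_eq_left)
    then show ?thesis
      by (simp add: objective_def G_def I_def r_def algebra_simps)
  qed
  show ?thesis
    unfolding strictly_convex_def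
  proof (intro ballI allI impI)
    fix u v :: "real vec" and t :: real
    assume uv: "u \<in> carrier_vec N" "v \<in> carrier_vec N" and t: "u \<noteq> v \<and> 0 < t \<and> t < 1"
    let ?w = "(1 - t) \<cdot>\<^sub>v u + t \<cdot>\<^sub>v v"
    have "H ?w \<le> (\<Sum>i\<in>I. (1 - t) * g (norm2 (vec_group K u i)) + t * g (norm2 (vec_group K v i)))"
      unfolding H_def vec_group_linear[OF uv] g_def using t
      by (intro sum_mono penalty_norm2_convex[OF assms(6) c, where n = K])
        (auto simp: vec_group_def)
    then have "H ?w \<le> (1 - t) * H u + t * H v"
      by (simp add: H_def sum.distrib sum_distrib_left)
    then have "lam * H ?w \<le> lam * ((1 - t) * H u + t * H v)"
      using assms(4) by simp
    moreover have "G ?w < (1 - t) * G u + t * G v"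
      using G uv t unfolding strictly_convex_def by blast
    ultimately show "objective \<phi> a lam N K y ?w
        < (1 - t) * objective \<phi> a lam N K y u + t * objective \<phi> a lam N K y v"
      using uv by (simp add: split algebra_simps)
  qed
qed

end
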